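(* Let $\mathcal H$ be a finite-dimensional complex Hilbert space, let $V\in\mathcal B(\mathcal H)$ be such that $p:=C_{\mathrm{Ad}_V}\in\mathcal B(\mathcal H\otimes\mathcal H)$ is a (rank one) projection, and let $\lambda>0$. If $$\frac1\lambda\ge\|\mathbf 1\otimes p+p\otimes\mathbf 1\|_{S(2)},$$ where $\mathbf 1$ is the identity of $\mathcal B(\mathcal H\otimes\mathcal H)$, then the map $(\mathrm{Tr}-\lambda\,\mathrm{Ad}_V)^{\otimes2}:\mathcal B(\mathcal H\otimes\mathcal H)\to\mathcal B(\mathcal H\otimes\mathcal H)$ is $2$-positive.
   Context: $\mathrm{Ad}_V(x)=VxV^*$, and $\mathrm{Tr}-\lambda\,\mathrm{Ad}_V$ denotes the map $x\mapsto\mathrm{Tr}(x)\mathbf 1-\lambda VxV^*$ on $\mathcal B(\mathcal H)$. The Choi matrix of a linear map $\phi$ on $\mathcal B(\mathcal H)$ is $C_\phi=\sum_{i,j}e_{ij}\otimes\phi(e_{ij})\in\mathcal B(\mathcal H\otimes\mathcal H)$, with $(e_{ij})$ the matrix units of a fixed orthonormal basis $(e_i)$ of $\mathcal H$. A linear map $\phi$ is $k$-positive if $\phi\otimes\mathrm{id}_{M_k(\mathbb C)}$ is positive (maps positive semidefinite operators to positive semidefinite operators). The operators $\mathbf 1\otimes p$ and $p\otimes\mathbf 1$ act on $(\mathcal H\hat\otimes\mathcal H)\otimes(\mathcal H\hat\otimes\mathcal H)$, where $\hat\otimes$ separates the input and output factor of each copy. Schmidt rank on this space is taken with respect to the bipartition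 $\hat\otimes$: identifying $(e_i\hat\otimes e_j)\otimes(e_k\hat\otimes e_l)$ with $(e_i\otimes e_k)\hat\otimes(e_j\otimes e_l)$, the Schmidt rank of $\chi=\sum\chi_{ik,jl}(e_i\otimes e_k)\hat\otimes(e_j\otimes e_l)$ is the rank of the $d^2\times d^2$ matrix $[\chi_{ik,jl}]$ with rows $(i,k)$ and columns $(j,l)$, $d=\dim\mathcal H$. For a positive operator $A$ on this space, $\|A\|_{S(2)}=\sup\langle\chi|A|\chi\rangle$ over unit vectors $\chi$ of Schmidt rank $\le2$. *)

theory Defs
  imports "HOL-Analysis.Analysis"
begin

(* Operators on a d-dimensional Hilbert space are matrices with respect to a fixed orthonormal
   basis indexed by a finite type.  The tensor product of the spaces with basis indices 'a and 'b
   has basis indices 'a * 'b, with (i, j) standing for e_i (x) e_j. *)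
type_synonym 'n cmat = "complex^'n^'n"

definition cscale :: "complex \<Rightarrow> complex^'n^'m \<Rightarrow> complex^'n^'m" where
  "cscale c A = (\<chi> i j. c * A $ i $ j)"

definition cadjoint :: "complex^'n^'m \<Rightarrow> complex^'m^'n" where
  "cadjoint A = (\<chi> i j. cnj (A $ j $ i))"

(* The library's inner product on complex^'n is the real part of this one, and its norm is the
   norm induced by either. *)
definition cinner :: "complex^'n \<Rightarrow> complex^'n \<Rightarrow> complex" where
  "cinner x y = (\<Sum>i\<in>UNIV. cnj (x $ i) * y $ i)"

definition psd :: "('n::finite) cmat \<Rightarrow> bool" where
  "psd A \<longleftrightarrow> (\<forall>x. cinner x (A *v x) \<in> \<real>\<^sub>\<ge>\<^sub>0)"

definition orth_projection :: "('n::finite) cmat \<Rightarrow> bool" where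
  "orth_projection P \<longleftrightarrow> P ** P = P \<and> cadjoint P = P"

definition matrix_unit :: "'n \<Rightarrow> 'n \<Rightarrow> ('n::finite) cmat" where
  "matrix_unit i j = (\<chi> a b. if a = i \<and> b = j then 1 else 0)"

definition tensor :: "('a::finite) cmat \<Rightarrow> ('b::finite) cmat \<Rightarrow> ('a \<times> 'b) cmat" where
  "tensor A B = (\<chi> a b. A $ fst a $ fst b * B $ snd a $ snd b)"

(* For linear f and g this is the linear map with A (x) B |-> f A (x) g B (see tensor_map_tensor);
   the formula expands X in the matrix units e_ij (x) e_kl, of which X $ (i, k) $ (j, l) is the
   coefficient. *)
definition tensor_map ::
  "(('a::finite) cmat \<Rightarrow> ('c::finite) cmat) \<Rightarrow> (('b::finite) cmat \<Rightarrow> ('d::finite) cmat)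
    \<Rightarrow> ('a \<times> 'b) cmat \<Rightarrow> ('c \<times> 'd) cmat" where
  "tensor_map f g X = (\<Sum>i\<in>UNIV. \<Sum>j\<in>UNIV. \<Sum>k\<in>UNIV. \<Sum>l\<in>UNIV.
     cscale (X $ (i, k) $ (j, l)) (tensor (f (matrix_unit i j)) (g (matrix_unit k l))))"

definition positive_map :: "(('a::finite) cmat \<Rightarrow> ('b::finite) cmat) \<Rightarrow> bool" where
  "positive_map f \<longleftrightarrow> (\<forall>X. psd X \<longrightarrow> psd (f X))"

(* k is given as a type of cardinality k, and M_k(C) is 'k cmat. *)
definition k_positive ::
  "'k::finite itself \<Rightarrow> (('a::finite) cmat \<Rightarrow> ('b::finite) cmat) \<Rightarrow> bool" where
  "k_positive K f \<longleftrightarrow> Vector_Spaces.linear cscale cscale f \<and>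
     positive_map (tensor_map f (id :: 'k cmat \<Rightarrow> 'k cmat))"

definition Ad :: "('n::finite) cmat \<Rightarrow> 'n cmat \<Rightarrow> 'n cmat" where
  "Ad V X = V ** X ** cadjoint V"

(* mat c is c times the identity matrix. *)
definition Tr_minus_Ad :: "real \<Rightarrow> ('n::finite) cmat \<Rightarrow> 'n cmat \<Rightarrow> 'n cmat" where
  "Tr_minus_Ad lam V X = mat (trace X) - cscale (complex_of_real lam) (Ad V X)"

definition choi :: "(('n::finite) cmat \<Rightarrow> 'n cmat) \<Rightarrow> ('n \<times> 'n) cmat" where
  "choi f = (\<Sum>i\<in>UNIV. \<Sum>j\<in>UNIV. tensor (matrix_unit i j) (f (matrix_unit i j)))"

(* The coordinate of w at ((i, j), (k, l)) belongs to two copies (i, j) and (k, l) of an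
   input-output pair.  The bipartition is inputs versus outputs, not first versus second copy:
   the coefficient matrix has row (i, k) and column (j, l). *)
definition schmidt_matrix ::
  "complex^(('n::finite \<times> 'n) \<times> ('n \<times> 'n)) \<Rightarrow> ('n \<times> 'n) cmat" where
  "schmidt_matrix w = (\<chi> r c. w $ ((fst r, fst c), (snd r, snd c)))"

definition schmidt_rank :: "complex^(('n::finite \<times> 'n) \<times> ('n \<times> 'n)) \<Rightarrow> nat" where
  "schmidt_rank w = rank (schmidt_matrix w)"

(* Meant for psd A, where the quadratic form is real.  For k >= 1 the supremum is over a
   nonempty set bounded above (see schmidt_norm_bdd_above). *)
definition schmidt_norm :: "nat \<Rightarrow> (('n::finite \<times> 'n) \<times> ('n \<times> 'n)) cmat \<Rightarrow> real" where
  "schmidt_norm k A = Sup {Re (cinner w (A *v w)) | w. norm w = 1 \<and> schmidt_rank w \<le> k}"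


lemma linear_sum_units:
  fixes f :: "('a::finite) cmat \<Rightarrow> ('c::finite) cmat"
  assumes "Vector_Spaces.linear cscale cscale f"
  shows "f A = (\<Sum>i\<in>UNIV. \<Sum>j\<in>UNIV. cscale (A $ i $ j) (f (matrix_unit i j)))"
proof -
  interpret Vector_Spaces.linear cscale cscale f by fact
  have "A = (\<Sum>i\<in>UNIV. \<Sum>j\<in>UNIV. cscale (A $ i $ j) (matrix_unit i j))"
    by (simp add: vec_eq_iff cscale_def matrix_unit_def if_distrib cong: if_cong)
      (simp add: sum.If_cases if_distrib [where f = "(*) _"] flip: if_if_eq_conj)
  then have "f A = f (\<Sum>i\<in>UNIV. \<Sum>j\<in>UNIV. cscale (A $ i $ j) (matrix_unit i j))"
    by simp
  then show ?thesis
    by (simp add: sum scale)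
qed

lemma tensor_map_tensor:
  assumes f: "Vector_Spaces.linear cscale cscale f" and g: "Vector_Spaces.linear cscale cscale g"
  shows "tensor_map f g (tensor A B) = tensor (f A) (g B)"
proof -
  have "f A $ a $ b * g B $ c $ d =
    (\<Sum>i\<in>UNIV. \<Sum>j\<in>UNIV. \<Sum>k\<in>UNIV. \<Sum>l\<in>UNIV.
       A $ i $ j * B $ k $ l * (f (matrix_unit i j) $ a $ b * g (matrix_unit k l) $ c $ d))"
    for a b c d
    by (subst linear_sum_units [OF f], subst linear_sum_units [OF g])
      (simp only: cscale_def sum_component vec_lambda_beta sum_distrib_right,
       simp only: sum_distrib_left mult_ac)
  then show ?thesis
    by (simp add: vec_eq_iff tensor_map_def tensor_def cscale_def)
qed

lemma linear_Tr_minus_Ad: "Vector_Spaces.linear cscale cscale (Tr_minus_Ad lam V)"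
  by unfold_locales
    (simp_all add: vec_eq_iff cscale_def Tr_minus_Ad_def Ad_def mat_def trace_def
      matrix_matrix_mult_def sum_distrib_left sum_distrib_right sum.distrib algebra_simps)

lemma schmidt_norm_bdd_above:
  "bdd_above {Re (cinner w (A *v w)) | w. norm w = 1 \<and> schmidt_rank w \<le> k}"
proof (rule bdd_aboveI)
  fix r
  assume "r \<in> {Re (cinner w (A *v w)) | w. norm w = 1 \<and> schmidt_rank w \<le> k}"
  then obtain w where r: "r = Re (cinner w (A *v w))" and w: "norm w = 1"
    by blast
  have w1: "cmod (w $ i) \<le> 1" for i
    using Finite_Cartesian_Product.norm_nth_le [of w i] w by simp
  have "cmod (cnj (w $ i) * (A $ i $ j * w $ j)) \<le> 1 * (cmod (A $ i $ j) * 1)" for i j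
    unfolding norm_mult complex_mod_cnj by (intro mult_mono w1) auto
  moreover have "cinner w (A *v w) = (\<Sum>i\<in>UNIV. \<Sum>j\<in>UNIV. cnj (w $ i) * (A $ i $ j * w $ j))"
    by (simp only: cinner_def matrix_vector_mult_def vec_lambda_beta sum_distrib_left)
  ultimately have "cmod (cinner w (A *v w)) \<le> (\<Sum>i\<in>UNIV. \<Sum>j\<in>UNIV. 1 * (cmod (A $ i $ j) * 1))"
    by (simp only:) (intro sum_norm_le)
  then show "r \<le> (\<Sum>i\<in>UNIV. \<Sum>j\<in>UNIV. 1 * (cmod (A $ i $ j) * 1))"
    using complex_Re_le_cmod [of "cinner w (A *v w)"] r by linarith
qed

end

(* The Choi matrix of Tr - lam Ad_V is 1 - lam p, so that of the tensor square is
   1 - lam (1 (x) p + p (x) 1) + lam^2 p (x) p, whose last term is positive.  A positive X is a sum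
   of rank-one matrices (split off one by one by Schur complements), and for X of rank one,
   <y, (phi (x) id_k)(X) y> is the quadratic form of the Choi matrix of phi at a vector whose
   coefficient matrix factors through C^k, that is, of Schmidt rank at most k. *)
theory Submission
  imports Defs
begin

section \<open>Quadratic forms and rank-one operators\<close>

lemma cinner_add_left: "cinner (x + y) z = cinner x z + cinner y z"
  by (simp add: cinner_def algebra_simps sum.distrib)

lemma cinner_add_right: "cinner x (y + z) = cinner x y + cinner x z"
  by (simp add: cinner_def algebra_simps sum.distrib)

lemma cinner_diff_right: "cinner x (y - z) = cinner x y - cinner x z"
  by (simp add: cinner_def algebra_simps sum_subtractf)

lemma cinner_axis_left: "cinner (axis k c) x = cnj c * x $ k"
proof -
  have "cinner (axis k c) x = (\<Sum>i\<in>UNIV. if i = k then cnj c * x $ k else 0)"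
    unfolding cinner_def by (rule sum.cong) (auto simp: axis_def)
  then show ?thesis by simp
qed

lemma matrix_vector_mult_axis: "(A *v axis k c) $ i = A $ i $ k * (c :: complex)"
proof -
  have "(A *v axis k c) $ i = (\<Sum>j\<in>UNIV. if j = k then A $ i $ k * c else 0)"
    unfolding matrix_vector_mult_def vec_lambda_beta by (rule sum.cong) (auto simp: axis_def)
  then show ?thesis by simp
qed

lemma cinner_matrix_vector_mult:
  "cinner x (A *v y) = (\<Sum>i\<in>UNIV. \<Sum>j\<in>UNIV. cnj (x $ i) * A $ i $ j * y $ j)"
  by (simp add: cinner_def matrix_vector_mult_def sum_distrib_left mult.assoc)

lemma cinner_self: "cinner x x = complex_of_real ((norm x)\<^sup>2)"
  by (simp add: cinner_def norm_vec_def L2_set_def sum_nonneg complex_norm_square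
      of_real_sum mult.commute del: of_real_power flip: of_real_power)

definition outer :: "complex^'n \<Rightarrow> ('n::finite) cmat" where
  "outer x = (\<chi> i j. x $ i * cnj (x $ j))"

lemma cinner_outer: "cinner z (outer x *v z) = complex_of_real ((cmod (cinner x z))\<^sup>2)"
proof -
  have "cinner z (outer x *v z) = cnj (cinner x z) * cinner x z"
    by (simp add: cinner_matrix_vector_mult outer_def) (simp add: cinner_def sum_product mult_ac)
  then show ?thesis
    by (simp add: complex_norm_square mult.commute del: of_real_power flip: of_real_power)
qed

text \<open>Conjugating the double sum of the form only exchanges its two summation indices.\<close>

lemma hermitian_form_real:
  assumes "cadjoint A = A"
  shows "Im (cinner x (A *v x)) = 0"
proof -
  have A: "cnj (A $ i $ j) = A $ j $ i" for i j
    using assms by (auto simp: cadjoint_def vec_eq_iff)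
  have "cnj (cinner x (A *v x)) = (\<Sum>i\<in>UNIV. \<Sum>j\<in>UNIV. cnj (x $ j) * A $ j $ i * x $ i)"
    by (simp add: cinner_matrix_vector_mult A mult_ac)
  also have "\<dots> = cinner x (A *v x)"
    by (subst sum.swap) (simp add: cinner_matrix_vector_mult)
  finally show ?thesis
    by (simp add: complex_eq_iff)
qed

text \<open>Perturbation along one basis vector. With \<open>x\<close> a basis vector it tests 2 by
  2 principal blocks; with arbitrary \<open>x\<close> it supplies the square completed in the Schur
  complement.\<close>

lemma cinner_two_axes:
  "cinner (x + axis k c) (A *v (x + axis k c)) =
    cinner x (A *v x) + c * cinner x (column k A) + cnj c * (A *v x) $ k + cnj c * A $ k $ k * c"
proof -
  have "A *v axis k c = (\<chi> i. c * column k A $ i)"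
    by (simp add: vec_eq_iff matrix_vector_mult_axis column_def mult.commute)
  then have "cinner x (A *v axis k c) = c * cinner x (column k A)"
    by (simp add: cinner_def sum_distrib_left mult_ac)
  then show ?thesis
    by (simp add: matrix_vector_right_distrib cinner_add_left cinner_add_right cinner_axis_left
        matrix_vector_mult_axis algebra_simps)
qed

section \<open>Decomposition of positive semidefinite matrices into rank-one terms\<close>

lemma psd_diagonal:
  assumes "psd A"
  shows "A $ k $ k \<in> \<real>\<^sub>\<ge>\<^sub>0"
proof -
  have "cinner (axis k 1) (A *v axis k 1) \<in> \<real>\<^sub>\<ge>\<^sub>0"
    using assms by (auto simp: psd_def)
  then show ?thesis
    by (simp add: cinner_axis_left matrix_vector_mult_axis)
qed

lemma psd_axes:
  assumes "psd A"
  shows "A $ j $ j + c * A $ j $ k + cnj c * A $ k $ j + cnj c * A $ k $ k * c \<in> \<real>\<^sub>\<ge>\<^sub>0"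
proof -
  have "cinner (axis j 1 + axis k c) (A *v (axis j 1 + axis k c)) \<in> \<real>\<^sub>\<ge>\<^sub>0"
    using assms by (auto simp: psd_def)
  then show ?thesis
    by (simp add: cinner_two_axes cinner_axis_left matrix_vector_mult_axis column_def)
qed

text \<open>The form is required to be real at every vector, so polarization applies: at
  \<open>e_j + e_k\<close> the imaginary parts of \<open>A $ j $ k\<close> and
  \<open>A $ k $ j\<close> cancel, and at \<open>e_j + i e_k\<close> their real parts agree.\<close>

lemma psd_hermitian:
  assumes "psd A"
  shows "cadjoint A = A"
proof -
  have "cnj (A $ k $ j) = A $ j $ k" for j k
    using psd_axes [OF assms, of j 1 k] psd_axes [OF assms, of j \<i> k]
      psd_diagonal [OF assms, of j] psd_diagonal [OF assms, of k]
    by (simp add: complex_nonneg_Reals_iff complex_eq_iff)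
  then show ?thesis
    by (simp add: cadjoint_def vec_eq_iff)
qed

lemma psd_zero_diagonal:
  assumes A: "psd A" and diag: "\<And>k. A $ k $ k = 0"
  shows "A = 0"
proof -
  have "A $ j $ k = 0" for j k
  proof -
    have "A $ k $ j = cnj (A $ j $ k)"
      using psd_hermitian [OF A] by (auto simp: cadjoint_def vec_eq_iff)
    then have "Re (A $ j $ k) * Re (A $ j $ k) + Im (A $ j $ k) * Im (A $ j $ k) \<le> 0"
      \<comment> \<open>With zero diagonal the form at \<open>e_j + c e_k\<close> is twice the real
        part of \<open>c * A $ j $ k\<close>. This choice of \<open>c\<close> makes it minus twice
        the squared modulus of the entry.\<close>
      using psd_axes [OF A, of j "- cnj (A $ j $ k)" k]
      by (simp add: diag complex_nonneg_Reals_iff)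
    then show ?thesis
      by (simp add: complex_eq_iff sum_squares_le_zero_iff)
  qed
  then show ?thesis
    by (simp add: vec_eq_iff)
qed

text \<open>The form of \<open>A - outer x\<close> at \<open>z\<close> is the minimum over
  \<open>c\<close> of the form of \<open>A\<close> at \<open>z + axis k c\<close>, and is therefore
  nonnegative.\<close>

lemma psd_schur_complement:
  assumes A: "psd A" and k: "A $ k $ k \<noteq> 0"
  obtains x where "psd (A - outer x)" and "(A - outer x) $ k $ k = 0"
proof -
  define a where "a = Re (A $ k $ k)"
  have a: "A $ k $ k = complex_of_real a" "a > 0"
    using psd_diagonal [OF A, of k] k by (auto simp: a_def complex_nonneg_Reals_iff complex_eq_iff)
  have herm: "cnj (A $ i $ j) = A $ j $ i" for i j
    using psd_hermitian [OF A] by (auto simp: cadjoint_def vec_eq_iff)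
  \<comment> \<open>The scaling by \<open>sqrt a\<close> makes \<open>outer x\<close> agree with
    \<open>A\<close> on the whole of row and column \<open>k\<close>.\<close>
  define x where "x = (\<chi> i. A $ i $ k / complex_of_real (sqrt a))"
  have sq: "complex_of_real (sqrt a) * complex_of_real (sqrt a) = complex_of_real a"
    using a by (simp flip: of_real_mult)
  have xz: "cinner x z = (A *v z) $ k / complex_of_real (sqrt a)" for z
    by (simp add: x_def cinner_def matrix_vector_mult_def herm sum_divide_distrib)
  have "cinner z ((A - outer x) *v z) \<in> \<real>\<^sub>\<ge>\<^sub>0" for z
  proof -
    define b where "b = (A *v z) $ k"
    have col: "cinner z (column k A) = cnj b"
      by (simp add: b_def cinner_def column_def matrix_vector_mult_def herm mult.commute)
    \<comment> \<open>The minimizer: it solves \<open>b + a * c = 0\<close>, that is, coordinate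
      \<open>k\<close> of \<open>A *v (z + axis k c)\<close> vanishes.\<close>
    define c where "c = - b / complex_of_real a"
    have "cinner (z + axis k c) (A *v (z + axis k c)) \<in> \<real>\<^sub>\<ge>\<^sub>0"
      using A by (auto simp: psd_def)
    also have "cinner (z + axis k c) (A *v (z + axis k c)) =
      cinner z (A *v z) - b * cnj b / complex_of_real a"
      using a unfolding cinner_two_axes col a(1) b_def [symmetric] c_def
      by (simp add: field_simps)
    also have "\<dots> = cinner z ((A - outer x) *v z)"
      by (simp add: matrix_vector_mult_diff_rdistrib cinner_diff_right cinner_outer xz
          complex_norm_square b_def sq del: of_real_power)
    finally show ?thesis .
  qed
  then have "psd (A - outer x)"
    by (simp add: psd_def)
  moreover have "(A - outer x) $ k $ k = 0"
    using a sq by (simp add: outer_def x_def field_simps)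
  ultimately show ?thesis
    by (rule that)
qed

text \<open>Induction on the number of nonzero diagonal entries: a Schur complement clears one of
  them and creates none. When all are zero, the matrix itself is zero.\<close>

lemma psd_induct [consumes 1, case_names zero add outer]:
  assumes "psd A" and zero: "P 0"
    and add: "\<And>A B. P A \<Longrightarrow> P B \<Longrightarrow> P (A + B)"
    and outer: "\<And>x. P (outer x)"
  shows "P A"
  using \<open>psd A\<close>
proof (induction "card {k. A $ k $ k \<noteq> 0}" arbitrary: A rule: less_induct)
  case less
  show ?case
  proof (cases "\<forall>k. A $ k $ k = 0")
    case True
    then show ?thesis
      using psd_zero_diagonal [OF less.prems] zero by simp
  next
    case False
    then obtain k where k: "A $ k $ k \<noteq> 0"
      by blast
    obtain x where x: "psd (A - outer x)" "(A - outer x) $ k $ k = 0"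
      using psd_schur_complement [OF less.prems k] .
    \<comment> \<open>A zero diagonal entry stays zero: otherwise subtracting the squared modulus of
      \<open>x $ j\<close> would make it negative.\<close>
    have "(A - outer x) $ j $ j = 0" if "A $ j $ j = 0" for j
    proof -
      have "- (x $ j * cnj (x $ j)) \<in> \<real>\<^sub>\<ge>\<^sub>0"
        using psd_diagonal [OF x(1), of j] that by (simp add: outer_def)
      then have "Re (x $ j) * Re (x $ j) + Im (x $ j) * Im (x $ j) \<le> 0"
        by (simp add: complex_nonneg_Reals_iff)
      then have "x $ j = 0"
        by (simp add: complex_eq_iff sum_squares_le_zero_iff)
      then show ?thesis
        using that by (simp add: outer_def)
    qed
    then have "{j. (A - outer x) $ j $ j \<noteq> 0} \<subset> {j. A $ j $ j \<noteq> 0}"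
      using k x(2) by blast
    then have "P (A - outer x)"
      using x(1) by (intro less.hyps psubset_card_mono) auto
    from add [OF this outer [of x]] show ?thesis
      by simp
  qed
qed

section \<open>Amplified maps on rank-one inputs\<close>

lemma tensor_map_zero: "tensor_map f g 0 = 0"
  by (simp add: tensor_map_def vec_eq_iff cscale_def)

lemma tensor_map_add: "tensor_map f g (A + B) = tensor_map f g A + tensor_map f g B"
  by (simp add: tensor_map_def vec_eq_iff cscale_def algebra_simps sum.distrib)

lemma linear_tensor_map: "Vector_Spaces.linear cscale cscale (tensor_map f g)"
  by unfold_locales
    (simp_all add: vec_eq_iff cscale_def tensor_map_def sum_distrib_left sum.distrib algebra_simps)

lemma sum_matrix_unit:
  "(\<Sum>k\<in>UNIV. \<Sum>l\<in>UNIV. h k l * matrix_unit k l $ s $ t) = h s t"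
proof -
  have "(\<Sum>k\<in>UNIV. \<Sum>l\<in>UNIV. h k l * matrix_unit k l $ s $ t) =
    (\<Sum>k\<in>UNIV. \<Sum>l\<in>UNIV. if l = t then if k = s then h s t else 0 else 0)"
    by (intro sum.cong refl) (auto simp: matrix_unit_def)
  then show ?thesis by simp
qed

lemma tensor_map_id_component:
  fixes f :: "('a::finite) cmat \<Rightarrow> ('b::finite) cmat"
  shows "tensor_map f (id :: 'k::finite cmat \<Rightarrow> 'k cmat) X $ (a, s) $ (b, t) =
    (\<Sum>i\<in>UNIV. \<Sum>j\<in>UNIV. X $ (i, s) $ (j, t) * f (matrix_unit i j) $ a $ b)"
proof -
  from sum_matrix_unit [of "\<lambda>k l. X $ (i, k) $ (j, l) * f (matrix_unit i j) $ a $ b" s t for i j]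
  show ?thesis
    by (simp add: tensor_map_def tensor_def cscale_def mult.assoc)
qed

text \<open>The right-hand side is the quadratic form of the Choi matrix of \<open>f\<close> at the
  vector with coefficient matrix \<open>W y\<close>. Summing out the ancilla index \<open>t\<close>
  exhibits \<open>W y\<close> as a product through a space of dimension \<open>CARD('k)\<close>,
  which is what limits its rank.\<close>

lemma cinner_tensor_map_id_outer:
  fixes f :: "('a::finite) cmat \<Rightarrow> ('b::finite) cmat" and x :: "complex^('a \<times> 'k::finite)"
  defines "W \<equiv> \<lambda>y i a. \<Sum>t\<in>UNIV. cnj (x $ (i, t)) * y $ (a, t)"
  shows "cinner y (tensor_map f (id :: 'k cmat \<Rightarrow> 'k cmat) (outer x) *v y) =
    (\<Sum>i\<in>UNIV. \<Sum>a\<in>UNIV. \<Sum>j\<in>UNIV. \<Sum>b\<in>UNIV.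
      cnj (W y i a) * f (matrix_unit i j) $ a $ b * W y j b)"
proof -
  have prod: "(\<Sum>u\<in>UNIV. h u) = (\<Sum>c\<in>UNIV. \<Sum>s\<in>UNIV. h (c, s))"
    for h :: "'b \<times> 'k \<Rightarrow> complex"
    by (simp add: sum.cartesian_product)
  have "cinner y (tensor_map f (id :: 'k cmat \<Rightarrow> 'k cmat) (outer x) *v y) =
    (\<Sum>a\<in>UNIV. \<Sum>s\<in>UNIV. \<Sum>b\<in>UNIV. \<Sum>t\<in>UNIV. \<Sum>i\<in>UNIV. \<Sum>j\<in>UNIV.
      cnj (y $ (a, s)) * (x $ (i, s) * cnj (x $ (j, t)) * f (matrix_unit i j) $ a $ b) * y $ (b, t))"
    unfolding cinner_matrix_vector_mult prod tensor_map_id_component outer_def vec_lambda_beta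
      sum_distrib_left sum_distrib_right ..
  \<comment> \<open>The ancilla indices \<open>s\<close> and \<open>t\<close> are moved innermost,
    where the sum over \<open>s\<close> gives \<open>cnj (W y i a)\<close> and the sum over
    \<open>t\<close> gives \<open>W y j b\<close>.\<close>
  also have "\<dots> = (\<Sum>i\<in>UNIV. \<Sum>a\<in>UNIV. \<Sum>j\<in>UNIV. \<Sum>b\<in>UNIV. \<Sum>s\<in>UNIV. \<Sum>t\<in>UNIV.
      cnj (y $ (a, s)) * (x $ (i, s) * cnj (x $ (j, t)) * f (matrix_unit i j) $ a $ b) * y $ (b, t))"
    unfolding sum.cartesian_product
    by (rule sum.reindex_bij_witness
        [of _ "\<lambda>(i, a, j, b, s, t). (a, s, b, t, i, j)" "\<lambda>(a, s, b, t, i, j). (i, a, j, b, s, t)"]) auto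
  also have "\<dots> = (\<Sum>i\<in>UNIV. \<Sum>a\<in>UNIV. \<Sum>j\<in>UNIV. \<Sum>b\<in>UNIV.
      cnj (W y i a) * f (matrix_unit i j) $ a $ b * W y j b)"
    by (simp add: W_def sum_distrib_left sum_distrib_right mult_ac)
  finally show ?thesis .
qed

section \<open>Rank bounds and the Schmidt norm\<close>

lemma rank_matrix_mult_le_card:
  fixes B :: "'a::field^'k^'m" and D :: "'a^'n^'k"
  shows "rank (B ** D) \<le> CARD('k)"
proof -
  have "row i (B ** D) = (\<Sum>t\<in>UNIV. B $ i $ t *s row t D)" for i
    by (simp add: vec_eq_iff row_def matrix_matrix_mult_def)
  moreover have "(\<Sum>t\<in>UNIV. B $ i $ t *s row t D) \<in> vec.span (rows D)" for i
    by (intro vec.span_sum vec.span_scale vec.span_base) (auto simp: rows_def)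
  ultimately have "rows (B ** D) \<subseteq> vec.span (rows D)"
    by (auto simp: rows_def)
  moreover have D: "rows D = (\<lambda>t. row t D) ` UNIV"
    by (auto simp: rows_def)
  ultimately have "rank (B ** D) \<le> card (rows D)"
    unfolding row_rank_def_gen by (intro vec.dim_le_card) auto
  also have "\<dots> \<le> CARD('k)"
    unfolding D by (rule card_image_le) simp
  finally show ?thesis .
qed

lemma rank_cscale_le: "rank (cscale c A) \<le> rank A"
proof -
  have "row i (cscale c A) = c *s row i A" for i
    by (simp add: row_def cscale_def vec_eq_iff)
  moreover have "c *s row i A \<in> vec.span (rows A)" for i
    by (intro vec.span_scale vec.span_base) (auto simp: rows_def)
  ultimately have "rows (cscale c A) \<subseteq> vec.span (rows A)"
    by (auto simp: rows_def)
  then show ?thesis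
    unfolding row_rank_def_gen by (rule vec.dim_mono)
qed

text \<open>Homogeneity: normalizing \<open>w\<close> does not raise its Schmidt rank and divides
  the form by the squared norm, so the supremum over unit vectors applies.\<close>

lemma schmidt_norm_bound:
  assumes "schmidt_rank w \<le> k"
  shows "Re (cinner w (A *v w)) \<le> schmidt_norm k A * (norm w)\<^sup>2"
proof (cases "w = 0")
  case True
  then show ?thesis by (simp add: cinner_def)
next
  case False
  define c where "c = complex_of_real (1 / norm w)"
  define u where "u = c *s w"
  have c: "cnj c = c"
    by (simp add: c_def)
  have "schmidt_matrix u = cscale c (schmidt_matrix w)"
    by (simp add: u_def schmidt_matrix_def cscale_def vec_eq_iff)
  then have "schmidt_rank u \<le> k"
    using assms rank_cscale_le order_trans unfolding schmidt_rank_def by metis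
  moreover have "u $ i = ((1 / norm w) *\<^sub>R w) $ i" for i
    unfolding u_def c_def vector_scaleR_component vector_smult_component
    by (simp add: scaleR_conv_of_real)
  then have "u = (1 / norm w) *\<^sub>R w"
    by (simp add: vec_eq_iff)
  then have "norm u = 1"
    using False by simp
  ultimately have "Re (cinner u (A *v u)) \<le> schmidt_norm k A"
    unfolding schmidt_norm_def by (intro cSup_upper schmidt_norm_bdd_above) auto
  moreover have "cinner u (A *v u) = c * (c * cinner w (A *v w))"
    by (simp add: u_def cinner_matrix_vector_mult c sum_distrib_left mult_ac)
  then have "Re (cinner u (A *v u)) = 1 / norm w * (1 / norm w * Re (cinner w (A *v w)))"
    unfolding c_def by (simp only: times_complex.sel Re_complex_of_real Im_complex_of_real) simp
  then have "Re (cinner u (A *v u)) = Re (cinner w (A *v w)) / (norm w)\<^sup>2"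
    by (simp add: power2_eq_square)
  ultimately show ?thesis
    using False by (simp add: field_simps)
qed

section \<open>Choi matrices\<close>

lemma matrix_unit_Pair: "matrix_unit (i, k) (j, l) = tensor (matrix_unit i j) (matrix_unit k l)"
  by (simp add: vec_eq_iff matrix_unit_def tensor_def)

lemma choi_component: "choi f $ (i, a) $ (j, b) = f (matrix_unit i j) $ a $ b"
  using sum_matrix_unit [of "\<lambda>k l. f (matrix_unit k l) $ a $ b" i j]
  by (simp add: choi_def tensor_def mult.commute)

text \<open>The Choi matrix of \<open>Ad V\<close> is the rank-one operator of the vectorization of
  \<open>V\<close>, whose coordinate at \<open>(i, a)\<close> is \<open>V $ a $ i\<close>.\<close>

lemma choi_Ad_component: "choi (Ad V) $ (i, a) $ (j, b) = V $ a $ i * cnj (V $ b $ j)"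
proof -
  have "Ad V (matrix_unit i j) $ a $ b = (\<Sum>k\<in>UNIV. \<Sum>l\<in>UNIV.
      if l = i then if k = j then V $ a $ i * cnj (V $ b $ j) else 0 else 0)"
    unfolding Ad_def matrix_matrix_mult_def vec_lambda_beta sum_distrib_right
    by (intro sum.cong refl) (auto simp: matrix_unit_def cadjoint_def)
  then show ?thesis
    by (simp add: choi_component)
qed

text \<open>The trace part sends \<open>matrix_unit i j\<close> to the identity if
  \<open>i = j\<close> and to zero otherwise, so its Choi matrix is the identity.\<close>

lemma choi_Tr_minus_Ad:
  "choi (Tr_minus_Ad lam V) = mat 1 - cscale (complex_of_real lam) (choi (Ad V))"
proof -
  have "trace (matrix_unit i j) = (if i = j then 1 else 0)" for i j :: 'a
  proof -
    have "trace (matrix_unit i j) = (\<Sum>k\<in>UNIV. if k = i then if i = j then 1 else 0 else 0)"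
      unfolding trace_def by (intro sum.cong refl) (auto simp: matrix_unit_def)
    then show ?thesis by simp
  qed
  then have "choi (Tr_minus_Ad lam V) $ (i, a) $ (j, b) =
    (mat 1 - cscale (complex_of_real lam) (choi (Ad V))) $ (i, a) $ (j, b)" for i a j b
    by (simp add: choi_component Tr_minus_Ad_def cscale_def mat_def)
  then show ?thesis
    by (simp add: vec_eq_iff split_paired_all)
qed

lemma cadjoint_tensor: "cadjoint (tensor A B) = tensor (cadjoint A) (cadjoint B)"
  by (simp add: cadjoint_def tensor_def vec_eq_iff)

lemma cadjoint_add: "cadjoint (A + B) = cadjoint A + cadjoint B"
  by (simp add: cadjoint_def vec_eq_iff)

lemma cadjoint_mat_1: "cadjoint (mat 1) = mat 1"
  by (auto simp: cadjoint_def mat_def vec_eq_iff)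

text \<open>The Choi matrix of \<open>tensor_map f g\<close> groups both inputs before both outputs,
  while \<open>tensor (choi f) (choi g)\<close> keeps the input and output of each copy together.
  The vector \<open>w\<close> is \<open>W\<close> rearranged accordingly.\<close>

lemma cinner_tensor_map_tensor_map_outer:
  fixes f g :: "('n::finite) cmat \<Rightarrow> 'n cmat" and x :: "complex^(('n \<times> 'n) \<times> 'k::finite)"
  assumes "Vector_Spaces.linear cscale cscale f" "Vector_Spaces.linear cscale cscale g"
  obtains w where "schmidt_rank w \<le> CARD('k)"
    and "cinner y (tensor_map (tensor_map f g) (id :: 'k cmat \<Rightarrow> 'k cmat) (outer x) *v y) =
      cinner w (tensor (choi f) (choi g) *v w)"
proof -
  define W where "W i a = (\<Sum>t\<in>UNIV. cnj (x $ (i, t)) * y $ (a, t))" for i a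
  define w :: "complex^(('n \<times> 'n) \<times> ('n \<times> 'n))" where
    "w = (\<chi> u. W (fst (fst u), fst (snd u)) (snd (fst u), snd (snd u)))"
  have w: "w $ ((i, j), (k, l)) = W (i, k) (j, l)" for i j k l
    by (simp add: w_def)
  have prod: "(\<Sum>u\<in>UNIV. h u) = (\<Sum>c\<in>UNIV. \<Sum>s\<in>UNIV. h (c, s))"
    for h :: "('a::finite) \<times> ('b::finite) \<Rightarrow> complex"
    by (simp add: sum.cartesian_product)
  \<comment> \<open>Passing to the Schmidt matrix undoes the rearrangement and returns
    \<open>W\<close>, which factors through the index type \<open>'k\<close>.\<close>
  have "schmidt_matrix w = (\<chi> i t. cnj (x $ (i, t))) ** (\<chi> t a. y $ (a, t))"
    by (simp add: schmidt_matrix_def w_def W_def matrix_matrix_mult_def vec_eq_iff)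
  then have rank: "schmidt_rank w \<le> CARD('k)"
    unfolding schmidt_rank_def by (metis rank_matrix_mult_le_card)
  have "cinner y (tensor_map (tensor_map f g) (id :: 'k cmat \<Rightarrow> 'k cmat) (outer x) *v y) =
    (\<Sum>i\<in>UNIV. \<Sum>k\<in>UNIV. \<Sum>a\<in>UNIV. \<Sum>c\<in>UNIV. \<Sum>j\<in>UNIV. \<Sum>l\<in>UNIV. \<Sum>b\<in>UNIV. \<Sum>d\<in>UNIV.
      cnj (W (i, k) (a, c)) * (choi f $ (i, a) $ (j, b) * choi g $ (k, c) $ (l, d)) * W (j, l) (b, d))"
    unfolding cinner_tensor_map_id_outer W_def [symmetric] prod matrix_unit_Pair
      tensor_map_tensor [OF assms] choi_component
    by (simp only: tensor_def vec_lambda_beta fst_conv snd_conv)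
  \<comment> \<open>Regrouping from inputs and outputs to first and second copy.\<close>
  also have "\<dots> =
    (\<Sum>i\<in>UNIV. \<Sum>a\<in>UNIV. \<Sum>k\<in>UNIV. \<Sum>c\<in>UNIV. \<Sum>j\<in>UNIV. \<Sum>b\<in>UNIV. \<Sum>l\<in>UNIV. \<Sum>d\<in>UNIV.
      cnj (W (i, k) (a, c)) * (choi f $ (i, a) $ (j, b) * choi g $ (k, c) $ (l, d)) * W (j, l) (b, d))"
    unfolding sum.cartesian_product
    by (rule sum.reindex_bij_witness [of _ "\<lambda>(i, a, k, c, j, b, l, d). (i, k, a, c, j, l, b, d)"
          "\<lambda>(i, k, a, c, j, l, b, d). (i, a, k, c, j, b, l, d)"]) auto
  also have "\<dots> = cinner w (tensor (choi f) (choi g) *v w)"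
    unfolding cinner_matrix_vector_mult prod w
    by (simp only: tensor_def vec_lambda_beta fst_conv snd_conv)
  finally show ?thesis
    by (rule that [OF rank])
qed

theorem proposition4:
  fixes V :: "complex^'n^'n" and p :: "complex^('n \<times> 'n)^('n \<times> 'n)" and lam :: real
  assumes "p = choi (Ad V)"
    and "orth_projection p"
    and "rank p = 1"
    and "lam > 0"
    and "1 / lam \<ge> schmidt_norm 2 (tensor (mat 1) p + tensor p (mat 1))"
  shows "k_positive TYPE(2) (tensor_map (Tr_minus_Ad lam V) (Tr_minus_Ad lam V))"
proof -
  define T where "T = Tr_minus_Ad lam V"
  define S where "S = tensor (mat 1) p + tensor p (mat 1)"
  \<comment> \<open>The tensor square of the vectorization of \<open>V\<close>, so that
    \<open>tensor p p\<close> is its rank-one operator.\<close>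
  define v :: "complex^(('n \<times> 'n) \<times> ('n \<times> 'n))" where
    "v = (\<chi> u. V $ snd (fst u) $ fst (fst u) * V $ snd (snd u) $ fst (snd u))"
  have S: "cadjoint S = S"
    using assms(2) by (simp add: S_def orth_projection_def cadjoint_add cadjoint_tensor cadjoint_mat_1)
  have pp: "tensor p p = outer v"
    by (simp add: vec_eq_iff split_paired_all tensor_def outer_def v_def assms(1) choi_Ad_component)
  have mat1: "tensor (mat 1) (mat 1) = (mat 1 :: (('n \<times> 'n) \<times> ('n \<times> 'n)) cmat)"
    by (auto simp: vec_eq_iff tensor_def mat_def)
  have "tensor (choi T) (choi T) =
      mat 1 - cscale (complex_of_real lam) S + cscale ((complex_of_real lam)\<^sup>2) (outer v)"
    by (simp add: T_def choi_Tr_minus_Ad S_def vec_eq_iff cscale_def tensor_def algebra_simps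
        power2_eq_square flip: assms(1) pp mat1)
  then have choi: "cinner w (tensor (choi T) (choi T) *v w) =
      of_real ((norm w)\<^sup>2) - of_real lam * cinner w (S *v w)
        + of_real (lam\<^sup>2 * (cmod (cinner v w))\<^sup>2)" for w
  proof -
    have scale: "cinner w (cscale c A *v w) = c * cinner w (A *v w)" for c A
      by (simp add: cinner_matrix_vector_mult cscale_def sum_distrib_left mult_ac)
    show ?thesis
      unfolding \<open>tensor (choi T) (choi T) = _\<close>
      by (simp only: matrix_vector_mult_add_rdistrib matrix_vector_mult_diff_rdistrib
          cinner_add_right cinner_diff_right scale cinner_outer matrix_vector_mul_lid cinner_self
          of_real_mult of_real_power)
  qed
  \<comment> \<open>This is block positivity: on Schmidt rank at most 2 the bound on
    \<open>S\<close> absorbs the term linear in \<open>lam\<close>, and the quadratic term is a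
    squared modulus.\<close>
  have block: "cinner w (tensor (choi T) (choi T) *v w) \<in> \<real>\<^sub>\<ge>\<^sub>0" if "schmidt_rank w \<le> 2" for w
  proof -
    have "Re (cinner w (S *v w)) \<le> schmidt_norm 2 S * (norm w)\<^sup>2"
      by (rule schmidt_norm_bound [OF that])
    also have "\<dots> \<le> 1 / lam * (norm w)\<^sup>2"
      using assms(5) by (intro mult_right_mono) (auto simp: S_def)
    finally have "lam * Re (cinner w (S *v w)) \<le> (norm w)\<^sup>2"
      using assms(4) by (simp add: field_simps)
    moreover have "0 \<le> lam\<^sup>2 * (cmod (cinner v w))\<^sup>2"
      by simp
    ultimately show ?thesis
      unfolding choi complex_nonneg_Reals_iff
      \<comment> \<open>Membership in the nonnegative reals also needs the imaginary part to vanish,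
        which follows from \<open>S\<close> being Hermitian.\<close>
      by (simp add: hermitian_form_real [OF S] del: of_real_mult of_real_power)
  qed
  have "cinner y (tensor_map (tensor_map T T) (id :: 2 cmat \<Rightarrow> 2 cmat) X *v y) \<in> \<real>\<^sub>\<ge>\<^sub>0"
    if "psd X" for X y
    \<comment> \<open>For fixed \<open>y\<close> the form is additive in \<open>X\<close>, so the
      claim reduces to rank-one \<open>X\<close>.\<close>
    using that
  proof (induction X rule: psd_induct)
    case zero
    show ?case
      by (simp add: tensor_map_zero cinner_def)
  next
    case (add A B)
    then show ?case
      by (simp add: tensor_map_add matrix_vector_mult_add_rdistrib cinner_add_right)
  next
    case (outer x)
    obtain w where "schmidt_rank w \<le> CARD(2)"
      and form: "cinner y (tensor_map (tensor_map T T) (id :: 2 cmat \<Rightarrow> 2 cmat) (outer x) *v y) =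
        cinner w (tensor (choi T) (choi T) *v w)"
      unfolding T_def
      by (rule cinner_tensor_map_tensor_map_outer [OF linear_Tr_minus_Ad linear_Tr_minus_Ad])
    then show ?case
      unfolding form by (intro block) simp
  qed
  then show ?thesis
    unfolding k_positive_def positive_map_def psd_def [of "tensor_map _ _ _"] T_def
    by (auto intro: linear_tensor_map)
qed

end
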